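(* Consider a single M/M/M cache, i.e. a TTL cache for one object with independent exponentially distributed inter-request times $X$, TTLs $T$ and object fetch delay $\Delta$ (with finite positive means). Set $\bar\tau_\Delta=\mathbb{E}[\Delta]/\mathbb{E}[X]$ and $\bar\tau_T=\mathbb{E}[T]/\mathbb{E}[X]$. Under the assumption that, given a miss, there is a request arrival exactly at the instant the object is admitted to the cache (the end of the fetch delay), the delay impairment is $$\eta=\frac{\bar\tau_\Delta}{\bar\tau_T+\bar\tau_\Delta+1}.$$
   Context: The delay impairment is $\eta := 1-\dfrac{P_h|_{\Delta\ge 0}}{P_h|_{\Delta=0}}$, where $P_h|_{\Delta\ge 0}$ is the object hit probability under the random delay $\Delta$ and $P_h|_{\Delta=0}$ is the object hit probability of the same cache with zero delay. The object hit probability under delay is $$P_h=\frac{\mathbb{E}[N]}{1+\mathbb{E}[m(\Delta)]+\mathbb{E}[N]},$$ where $N$ is the number of hits in one miss cycle, and $m(\delta)$ is the expected number of requests of the (here Poisson) request process arriving within a delay of length $\delta$ following the miss that starts the cycle (such requests are counted as misses); $\Delta$ is independent of the request process. Under the stated assumption, from the admission instant onwards each next request is independently a hit with probability $q=\mathbb{P}(X<T)$ (the TTL is renewed at each hit), and the first non-hit ends the cycle, so that $\mathbb{P}(N=n)=q^n(1-q)$ for $n\ge 0$. With zero delay, $P_h|_{\Delta=0}=\mathbb{P}(X<T)$. *)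

theory Defs
  imports "HOL-Probability.Probability"
begin

text \<open>
  One miss cycle starts at time 0 with the miss that triggers the fetch. Its randomness is
  \<^item> \<open>X i\<close>: inter-request times of the request process following that miss,
  \<^item> \<open>D\<close>: the fetch delay, so that \<open>D\<close> is also the instant of admission,
  \<^item> \<open>Y i\<close>: inter-request times from the admission instant onwards,
  \<^item> \<open>T i\<close>: the TTL set at admission (\<open>i = 0\<close>) and renewed at the \<open>i\<close>-th hit (\<open>i > 0\<close>).
  The assumption that a request arrives exactly at admission makes that instant a renewal point
  of the request process, which is why the inter-request times after it form a family of their own.
\<close>

datatype clock = Before nat | After nat | TTL nat | Fetch

text \<open>All random times of a cycle as one family, so that joint independence can be stated.\<close>

fun clock_var ::
  "(nat \<Rightarrow> 'a \<Rightarrow> real) \<Rightarrow> (nat \<Rightarrow> 'a \<Rightarrow> real) \<Rightarrow> (nat \<Rightarrow> 'a \<Rightarrow> real) \<Rightarrow> ('a \<Rightarrow> real)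
    \<Rightarrow> clock \<Rightarrow> 'a \<Rightarrow> real" where
  "clock_var X Y T D (Before i) = X i"
| "clock_var X Y T D (After i) = Y i"
| "clock_var X Y T D (TTL i) = T i"
| "clock_var X Y T D Fetch = D"

text \<open>
  \<open>m(\<delta>)\<close>. The miss at time 0 is not counted. The set is finite almost surely for the
  processes considered here, so the convention that infinite sets have cardinality 0 is harmless.
\<close>

definition mean_arrivals :: "'a measure \<Rightarrow> (nat \<Rightarrow> 'a \<Rightarrow> real) \<Rightarrow> real \<Rightarrow> real" where
  "mean_arrivals M X \<delta> = (\<integral>\<omega>. real (card {k. (\<Sum>i\<le>k. X i \<omega>) \<le> \<delta>}) \<partial>M)"

text \<open>Index 0 is the request that arrives exactly at the admission instant.\<close>

definition request_time :: "(nat \<Rightarrow> 'a \<Rightarrow> real) \<Rightarrow> ('a \<Rightarrow> real) \<Rightarrow> nat \<Rightarrow> 'a \<Rightarrow> real" where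
  "request_time Y D k \<omega> = D \<omega> + (\<Sum>i<k. Y i \<omega>)"

definition expiry_time ::
  "(nat \<Rightarrow> 'a \<Rightarrow> real) \<Rightarrow> (nat \<Rightarrow> 'a \<Rightarrow> real) \<Rightarrow> ('a \<Rightarrow> real) \<Rightarrow> nat \<Rightarrow> 'a \<Rightarrow> real" where
  "expiry_time Y T D k \<omega> = request_time Y D k \<omega> + T k \<omega>"

text \<open>
  The number \<open>N\<close> of hits in the cycle: request \<open>n + 1\<close> after admission is a hit of this cycle iff
  it and all earlier ones arrive before the TTL last set has expired, as the first non-hit ends
  the cycle. The request at the admission instant itself is not counted as a hit.
\<close>

definition num_hits ::
  "(nat \<Rightarrow> 'a \<Rightarrow> real) \<Rightarrow> (nat \<Rightarrow> 'a \<Rightarrow> real) \<Rightarrow> ('a \<Rightarrow> real) \<Rightarrow> 'a \<Rightarrow> nat" where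
  "num_hits Y T D \<omega> =
    card {n. \<forall>j\<le>n. request_time Y D (Suc j) \<omega> < expiry_time Y T D j \<omega>}"

definition hit_probability ::
  "'a measure \<Rightarrow> (nat \<Rightarrow> 'a \<Rightarrow> real) \<Rightarrow> (nat \<Rightarrow> 'a \<Rightarrow> real) \<Rightarrow> (nat \<Rightarrow> 'a \<Rightarrow> real)
    \<Rightarrow> ('a \<Rightarrow> real) \<Rightarrow> real" where
  "hit_probability M X Y T D =
    (\<integral>\<omega>. real (num_hits Y T D \<omega>) \<partial>M) /
    (1 + (\<integral>\<omega>. mean_arrivals M X (D \<omega>) \<partial>M) + (\<integral>\<omega>. real (num_hits Y T D \<omega>) \<partial>M))"

definition delay_impairment ::
  "'a measure \<Rightarrow> (nat \<Rightarrow> 'a \<Rightarrow> real) \<Rightarrow> (nat \<Rightarrow> 'a \<Rightarrow> real) \<Rightarrow> (nat \<Rightarrow> 'a \<Rightarrow> real)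
    \<Rightarrow> ('a \<Rightarrow> real) \<Rightarrow> real" where
  "delay_impairment M X Y T D =
    1 - hit_probability M X Y T D / hit_probability M X Y T (\<lambda>_. 0)"

end

theory Submission
  imports Defs
begin

text \<open>
  The mean of a count of events is the sum of their probabilities. For the hits this is the
  geometric series in \<open>q = P(Y < T)\<close>, so that \<open>E[N] = q / (1 - q)\<close>, the ratio of the rates of the
  requests and of the TTLs. For the arrivals within \<open>\<delta>\<close>, the \<open>k\<close>-th arrival time has an Erlang
  density, and these densities sum to the constant rate on the positive half-line, so that \<open>m(\<delta>)\<close>
  is linear in \<open>\<delta>\<close>.
\<close>

context prob_space
begin

text \<open>The count is a sum of indicators, and for nonnegative terms sum and integral commute.
  Since \<open>card\<close> is 0 on infinite sets, this needs the set to be finite almost surely,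
  which the summable probabilities provide.\<close>

lemma expectation_card:
  assumes [measurable]: "\<And>n::nat. Measurable.pred M (P n)"
    and sums: "(\<lambda>n. \<P>(\<omega> in M. P n \<omega>)) sums s"
  shows "expectation (\<lambda>\<omega>. real (card {n. P n \<omega>})) = s"
proof -
  let ?A = "\<lambda>n. {\<omega> \<in> space M. P n \<omega>}"
  have [measurable]: "(\<lambda>\<omega>. card {n. P n \<omega>}) \<in> measurable M (count_space UNIV)"
    by (rule measurable_card) simp
  \<comment> \<open>Borel-Cantelli: almost surely only finitely many \<open>P n\<close>
    hold.\<close>
  have "AE \<omega> in M. eventually (\<lambda>n. \<omega> \<in> space M - ?A n) sequentially"
    using sums by (intro borel_cantelli_AE1) (auto simp: sums_iff emeasure_eq_measure)
  then have AE: "AE \<omega> in M. ennreal (real (card {n. P n \<omega>})) = (\<Sum>n. indicator (?A n) \<omega>)"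
  proof eventually_elim
    case (elim \<omega>)
    then obtain k where k: "\<And>n. n \<ge> k \<Longrightarrow> \<omega> \<in> space M - ?A n"
      by (auto simp: eventually_sequentially)
    then have \<omega>: "\<omega> \<in> space M"
      by blast
    have "n < k" if "P n \<omega>" for n
      using k[of n] that by (cases "n < k") auto
    then have fin: "finite {n. P n \<omega>}"
      by (auto intro: finite_subset[OF _ finite_lessThan[of k]])
    have "(\<Sum>n. indicator (?A n) \<omega> :: ennreal) = (\<Sum>n\<in>{n. P n \<omega>}. indicator (?A n) \<omega>)"
      using fin by (intro suminf_finite) auto
    also have "\<dots> = of_nat (card {n. P n \<omega>})"
      using \<omega> by simp
    finally show ?case
      by (simp add: ennreal_of_nat_eq_real_of_nat)
  qed
  have "(\<integral>\<^sup>+\<omega>. ennreal (real (card {n. P n \<omega>})) \<partial>M) = (\<Sum>n. emeasure M (?A n))"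
    using AE by (simp add: nn_integral_cong_AE nn_integral_suminf)
  also have "\<dots> = ennreal s"
    using sums by (simp add: emeasure_eq_measure suminf_ennreal2 sums_iff)
  finally have "(\<integral>\<^sup>+\<omega>. ennreal (real (card {n. P n \<omega>})) \<partial>M) = ennreal s" .
  moreover have "0 \<le> s"
    using sums by (auto simp: sums_iff intro!: suminf_nonneg)
  ultimately show ?thesis
    by (subst integral_eq_nn_integral) auto
qed

text \<open>Given \<open>X = x\<close> with x \<ge> 0, the event has probability exp(-u x). This
  factor turns the density of rate \<open>l\<close> into \<open>l / (l + u)\<close> times the
  density of rate \<open>l + u\<close>, whose total mass is 1.\<close>

lemma exponential_less_prob:
  assumes [arith]: "0 < l" "0 < u"
    and X: "distributed M lborel X (exponential_density l)"
    and Y: "distributed M lborel Y (exponential_density u)"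
    and ind: "indep_var borel X borel Y"
  shows "\<P>(\<omega> in M. X \<omega> < Y \<omega>) = l / (l + u)"
proof -
  have ind': "indep_var lborel X lborel Y"
    using ind by (simp add: indep_var_eq)
  have XY: "distributed M (lborel \<Otimes>\<^sub>M lborel) (\<lambda>\<omega>. (X \<omega>, Y \<omega>))
      (\<lambda>(x, y). ennreal (exponential_density l x) * ennreal (exponential_density u y))"
    by (intro distributed_joint_indep X Y ind' sigma_finite_lborel)
  have tail: "(\<integral>\<^sup>+y. ennreal (exponential_density u y) * indicator {x<..} y \<partial>lborel) = ennreal (exp (- u * x))"
    if "0 \<le> x" for x
  proof -
    have "(\<integral>\<^sup>+y. ennreal (exponential_density u y) * indicator {x<..} y \<partial>lborel)
        = emeasure M (Y -` {x<..} \<inter> space M)"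
      using Y by (subst distributed_emeasure) auto
    also have "\<dots> = ennreal \<P>(\<omega> in M. x < Y \<omega>)"
      by (auto simp: emeasure_eq_measure intro!: arg_cong[where f=prob])
    finally show ?thesis
      using exponential_distributedD_gt[OF Y \<open>0 \<le> x\<close>] by (simp add: mult.commute)
  qed
  have [measurable]: "{z :: real \<times> real. fst z < snd z} \<in> sets (borel \<Otimes>\<^sub>M borel)"
    unfolding borel_prod by (intro borel_open open_Collect_less continuous_intros)
  have "emeasure M {\<omega> \<in> space M. X \<omega> < Y \<omega>} =
      emeasure M ((\<lambda>\<omega>. (X \<omega>, Y \<omega>)) -` {z. fst z < snd z} \<inter> space M)"
    by (auto intro!: arg_cong[where f="emeasure M"])
  also have "\<dots> = (\<integral>\<^sup>+z. (case z of (x, y) \<Rightarrow>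
      ennreal (exponential_density l x) * ennreal (exponential_density u y)) *
      indicator {z. fst z < snd z} z \<partial>(lborel \<Otimes>\<^sub>M lborel))"
    by (rule distributed_emeasure[OF XY]) measurable
  also have "\<dots> = (\<integral>\<^sup>+x. (\<integral>\<^sup>+y. ennreal (exponential_density l x) *
      (ennreal (exponential_density u y) * indicator {x<..} y) \<partial>lborel) \<partial>lborel)"
    by (subst lborel.nn_integral_fst[symmetric])
       (auto simp: mult.assoc split: split_indicator intro!: nn_integral_cong)
  also have "\<dots> = (\<integral>\<^sup>+x. ennreal (exponential_density l x) *
      (\<integral>\<^sup>+y. ennreal (exponential_density u y) * indicator {x<..} y \<partial>lborel) \<partial>lborel)"
    by (intro nn_integral_cong nn_integral_cmult) auto
  also have "\<dots> = (\<integral>\<^sup>+x. ennreal (l / (l + u)) * ennreal (exponential_density (l + u) x) \<partial>lborel)"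
  proof (intro nn_integral_cong)
    fix x
    show "ennreal (exponential_density l x) *
        (\<integral>\<^sup>+y. ennreal (exponential_density u y) * indicator {x<..} y \<partial>lborel) =
        ennreal (l / (l + u)) * ennreal (exponential_density (l + u) x)"
    proof (cases "x < 0")
      case False
      have "exponential_density l x * exp (- u * x) = l / (l + u) * exponential_density (l + u) x"
        by (simp add: exponential_density_def mult_exp_exp algebra_simps flip: add_divide_distrib)
           (simp add: field_simps)
      with False show ?thesis
        by (simp add: tail exponential_density_nonneg flip: ennreal_mult)
    qed (simp add: exponential_density_def)
  qed
  also have "\<dots> = ennreal (l / (l + u)) * (\<integral>\<^sup>+x. ennreal (exponential_density (l + u) x) \<partial>lborel)"
    by (rule nn_integral_cmult) auto
  \<comment> \<open>Total mass as the zeroth moment of the Erlang density of index 0, which is the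
    exponential one.\<close>
  also have "\<dots> = ennreal (l / (l + u))"
    using nn_integral_erlang_ith_moment[of "l + u" 0 0] by simp
  finally show ?thesis
    by (simp add: emeasure_eq_measure)
qed

end

text \<open>Up to the factor \<open>l * exp (- l * x)\<close>, the terms are those of the
  exponential series at \<open>l * x\<close>, so the exponentials cancel.\<close>

lemma erlang_density_sums:
  assumes "0 \<le> x"
  shows "(\<lambda>k. erlang_density k l x) sums l"
proof -
  have "(\<lambda>k. l * exp (- l * x) * ((l * x) ^ k /\<^sub>R fact k)) sums (l * exp (- l * x) * exp (l * x))"
    by (intro sums_mult exp_converges)
  with assms show ?thesis
    by (simp add: erlang_density_def[abs_def] mult.assoc exp_minus power_mult_distrib field_simps not_less)
qed

text \<open>Integrating the sum of the densities over the half-line up to \<open>a\<close> gives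
  \<open>l\<close> times the length of \<open>{0..a}\<close>. The maximum covers negative
  \<open>a\<close>, where that interval is empty.\<close>

lemma erlang_CDF_sums:
  assumes [arith]: "0 < l"
  shows "(\<lambda>k. erlang_CDF k l a) sums (l * max 0 a)"
proof -
  have "(\<Sum>k. ennreal (erlang_CDF k l a)) =
      (\<Sum>k. \<integral>\<^sup>+x. ennreal (erlang_density k l x) * indicator {..a} x \<partial>lborel)"
    by (simp add: nn_integral_erlang_density)
  also have "\<dots> = (\<integral>\<^sup>+x. (\<Sum>k. ennreal (erlang_density k l x) * indicator {..a} x) \<partial>lborel)"
    by (rule nn_integral_suminf[symmetric]) auto
  also have "\<dots> = (\<integral>\<^sup>+x. ennreal l * indicator {0..a} x \<partial>lborel)"
  proof (intro nn_integral_cong)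
    fix x :: real
    show "(\<Sum>k. ennreal (erlang_density k l x) * indicator {..a} x) = ennreal l * indicator {0..a} x"
    proof (cases "0 \<le> x")
      case True
      then have "(\<Sum>k. ennreal (erlang_density k l x)) = ennreal l"
        using erlang_density_sums[OF True, of l] by (simp add: sums_iff suminf_ennreal2)
      with True show ?thesis
        by (cases "x \<le> a") simp_all
    qed (simp add: erlang_density_def)
  qed
  also have "\<dots> = ennreal (l * max 0 a)"
    by (cases "0 \<le> a") (auto simp: nn_integral_cmult_indicator ennreal_mult)
  finally have *: "(\<Sum>k. ennreal (erlang_CDF k l a)) = ennreal (l * max 0 a)" .
  \<comment> \<open>The identity so far lives in \<open>ennreal\<close>; its finite value yields
    convergence of the real series.\<close>
  have "summable (\<lambda>k. erlang_CDF k l a)"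
    using * by (intro summable_suminf_not_top) auto
  moreover from this * have "(\<Sum>k. erlang_CDF k l a) = l * max 0 a"
    by (simp add: suminf_ennreal2 suminf_nonneg)
  ultimately show ?thesis
    by (simp add: sums_iff)
qed

context prob_space
begin

lemma mean_arrivals_poisson:
  assumes l: "0 < l"
    and X: "\<And>i. distributed M lborel (X i) (exponential_density l)"
    and ind: "indep_vars (\<lambda>_. borel) X UNIV"
  shows "mean_arrivals M X \<delta> = l * max 0 \<delta>"
  unfolding mean_arrivals_def
proof (rule expectation_card)
  have [measurable]: "X i \<in> borel_measurable M" for i
    using distributed_measurable[OF X] by simp
  show "Measurable.pred M (\<lambda>\<omega>. (\<Sum>i\<le>k. X i \<omega>) \<le> \<delta>)" for k
    by measurable
  \<comment> \<open>Index \<open>k\<close> of \<open>erlang_density\<close> stands for shape k + 1,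
    matching the k + 1 summands of the k-th arrival time.\<close>
  have S: "distributed M lborel (\<lambda>\<omega>. \<Sum>i\<le>k. X i \<omega>) (erlang_density k l)" for k
    using exponential_distributed_sum[OF finite_atMost _ l X indep_vars_subset[OF ind], of k] by simp
  have "\<P>(\<omega> in M. (\<Sum>i\<le>k. X i \<omega>) \<le> \<delta>) = erlang_CDF k l \<delta>" for k
  proof -
    have "ennreal \<P>(\<omega> in M. (\<Sum>i\<le>k. X i \<omega>) \<le> \<delta>) = emeasure M ((\<lambda>\<omega>. \<Sum>i\<le>k. X i \<omega>) -` {..\<delta>} \<inter> space M)"
      by (auto simp: emeasure_eq_measure intro!: arg_cong[where f=prob])
    also have "\<dots> = ennreal (erlang_CDF k l \<delta>)"
      using l by (subst distributed_emeasure[OF S]) (auto simp: nn_integral_erlang_density)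
    finally show ?thesis
      using l by simp
  qed
  then show "(\<lambda>k. \<P>(\<omega> in M. (\<Sum>i\<le>k. X i \<omega>) \<le> \<delta>)) sums (l * max 0 \<delta>)"
    using erlang_CDF_sums[OF l] by simp
qed

text \<open>Request \<open>Suc j\<close> and the TTL set at request \<open>j\<close> are both
  measured from request \<open>j\<close>, so the hit condition reduces to \<open>Y j < T j\<close>.
  The admission instant cancels; hence \<open>D'\<close> is arbitrary and the result serves both the
  random and the zero delay.\<close>

lemma expectation_num_hits:
  assumes [arith]: "0 < l" "0 < u"
    and Y: "\<And>i. distributed M lborel (Y i) (exponential_density l)"
    and T: "\<And>i. distributed M lborel (T i) (exponential_density u)"
    and ind: "indep_vars (\<lambda>_. borel) (clock_var X Y T D) UNIV"
  shows "expectation (\<lambda>\<omega>. real (num_hits Y T D' \<omega>)) = l / u"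
proof -
  have [measurable]: "Y i \<in> borel_measurable M" "T i \<in> borel_measurable M" for i
    using distributed_measurable[OF Y] distributed_measurable[OF T] by simp_all
  have YT: "\<P>(\<omega> in M. Y i \<omega> < T i \<omega>) = l / (l + u)" for i
  proof (rule exponential_less_prob[OF _ _ Y T])
    have "indep_var (PiM {After i} (\<lambda>_. borel)) (\<lambda>\<omega>. restrict (\<lambda>j. clock_var X Y T D j \<omega>) {After i})
        (PiM {TTL i} (\<lambda>_. borel)) (\<lambda>\<omega>. restrict (\<lambda>j. clock_var X Y T D j \<omega>) {TTL i})"
      by (rule indep_var_restrict[OF ind]) auto
    from indep_var_compose[OF this measurable_component_singleton[of "After i"]
        measurable_component_singleton[of "TTL i"]]
    show "indep_var borel (Y i) borel (T i)"
      by (simp add: comp_def)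
  qed simp_all
  \<comment> \<open>The blocks pairing \<open>After i\<close> with \<open>TTL i\<close> are
    disjoint, so the comparisons made within them are independent across \<open>i\<close>.\<close>
  let ?K = "\<lambda>i. {After i, TTL i}"
  have "indep_vars (\<lambda>i. PiM (?K i) (\<lambda>_. borel)) (\<lambda>i \<omega>. restrict (\<lambda>j. clock_var X Y T D j \<omega>) (?K i)) UNIV"
    by (rule indep_vars_restrict[OF ind]) (auto simp: disjoint_family_on_def)
  then have "indep_vars (\<lambda>_. count_space UNIV)
      (\<lambda>i \<omega>. (\<lambda>g. (g (After i) :: real) < g (TTL i)) (restrict (\<lambda>j. clock_var X Y T D j \<omega>) (?K i))) UNIV"
    by (rule indep_vars_compose2) measurable
  then have ind': "indep_vars (\<lambda>_. count_space UNIV) (\<lambda>i \<omega>. Y i \<omega> < T i \<omega>) UNIV"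
    by simp
  \<comment> \<open>This is the tail probability P(N > n): n + 1 independent successes, hence the
    exponent \<open>Suc n\<close>.\<close>
  have prob: "\<P>(\<omega> in M. \<forall>j\<le>n. Y j \<omega> < T j \<omega>) = (l / (l + u)) ^ Suc n" for n
  proof -
    have "\<P>(\<omega> in M. \<forall>j\<le>n. Y j \<omega> < T j \<omega>) =
        prob (\<Inter>j\<in>{..n}. (\<lambda>\<omega>. Y j \<omega> < T j \<omega>) -` {True} \<inter> space M)"
      by (auto intro!: arg_cong[where f=prob])
    also have "\<dots> = (\<Prod>j\<in>{..n}. prob ((\<lambda>\<omega>. Y j \<omega> < T j \<omega>) -` {True} \<inter> space M))"
      by (rule indep_varsD[OF ind']) auto
    also have "\<dots> = (\<Prod>j\<in>{..n}. \<P>(\<omega> in M. Y j \<omega> < T j \<omega>))"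
      by (auto intro!: prod.cong arg_cong[where f=prob])
    finally show ?thesis
      by (simp add: YT)
  qed
  have "expectation (\<lambda>\<omega>. real (card {n. \<forall>j\<le>n. Y j \<omega> < T j \<omega>})) = l / u"
  proof (rule expectation_card)
    have "(\<lambda>n. l / (l + u) * (l / (l + u)) ^ n) sums (l / (l + u) * (1 / (1 - l / (l + u))))"
      by (intro sums_mult geometric_sums) (auto simp: field_simps)
    also have "l / (l + u) * (1 / (1 - l / (l + u))) = l / u"
      using assms(1,2) by (simp add: divide_simps)
    finally show "(\<lambda>n. \<P>(\<omega> in M. \<forall>j\<le>n. Y j \<omega> < T j \<omega>)) sums (l / u)"
      by (simp add: prob)
  qed measurable
  then show ?thesis
    by (simp add: num_hits_def request_time_def expiry_time_def)
qed

end

theorem lemma1: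
  fixes M :: "'a measure"
    and X Y T :: "nat \<Rightarrow> 'a \<Rightarrow> real"
    and D :: "'a \<Rightarrow> real"
    and rate_X rate_T rate_D tau_D tau_T :: real
  assumes "prob_space M"
    and "rate_X > 0" and "rate_T > 0" and "rate_D > 0"
    and "\<And>i. distributed M lborel (X i) (exponential_density rate_X)"
    and "\<And>i. distributed M lborel (Y i) (exponential_density rate_X)"
    and "\<And>i. distributed M lborel (T i) (exponential_density rate_T)"
    and "distributed M lborel D (exponential_density rate_D)"
    and "prob_space.indep_vars M (\<lambda>_. borel) (clock_var X Y T D) UNIV"
    and "tau_D = (\<integral>\<omega>. D \<omega> \<partial>M) / (\<integral>\<omega>. X 0 \<omega> \<partial>M)"
    and "tau_T = (\<integral>\<omega>. T 0 \<omega> \<partial>M) / (\<integral>\<omega>. X 0 \<omega> \<partial>M)"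
  shows "delay_impairment M X Y T D = tau_D / (tau_T + tau_D + 1)"
proof -
  interpret prob_space M by fact
  note rates = assms(2-4)
  \<comment> \<open>Singleton blocks \<open>{Before i}\<close> reindex the joint family to
    \<open>X\<close> alone.\<close>
  have X: "indep_vars (\<lambda>_. borel) X UNIV"
  proof -
    have "indep_vars (\<lambda>i. PiM {Before i} (\<lambda>_. borel))
        (\<lambda>i \<omega>. restrict (\<lambda>j. clock_var X Y T D j \<omega>) {Before i}) UNIV"
      by (rule indep_vars_restrict[OF assms(9)]) (auto simp: disjoint_family_on_def)
    then have "indep_vars (\<lambda>_. borel)
        (\<lambda>i \<omega>. restrict (\<lambda>j. clock_var X Y T D j \<omega>) {Before i} (Before i)) UNIV"
      by (rule indep_vars_compose2) simp
    then show ?thesis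
      by simp
  qed
  note m = mean_arrivals_poisson[OF rates(1) assms(5) X]
  note N = expectation_num_hits[OF rates(1,2) assms(6,7,9)]
  note E = exponential_distributed_expectation[OF rates(1) assms(5)]
    exponential_distributed_expectation[OF rates(2) assms(7)]
    exponential_distributed_expectation[OF rates(3) assms(8)]
  have [measurable]: "D \<in> borel_measurable M"
    using distributed_measurable[OF assms(8)] by simp
  \<comment> \<open>The delay is almost surely nonnegative, so the maximum in m(\<delta>) drops out
    and E[m(D)] is \<open>rate_X\<close> times E[D].\<close>
  have "AE \<omega> in M. 0 \<le> D \<omega>"
    by (subst distributed_AE2[OF assms(8)]) (auto simp: exponential_density_def)
  then have "AE \<omega> in M. max 0 (D \<omega>) = D \<omega>"
    by eventually_elim simp
  then have "expectation (\<lambda>\<omega>. mean_arrivals M X (D \<omega>)) = expectation (\<lambda>\<omega>. rate_X * D \<omega>)"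
    unfolding m by (intro integral_cong_AE) auto
  also have "\<dots> = rate_X / rate_D"
    by (simp add: E)
  finally have mD: "expectation (\<lambda>\<omega>. mean_arrivals M X (D \<omega>)) = rate_X / rate_D" .
  \<comment> \<open>Exponential means are reciprocal rates. Hence \<open>tau_D\<close> is the mean
    number of arrivals during the fetch and \<open>tau_T\<close> is E[N].\<close>
  have tau: "tau_D = rate_X / rate_D" "tau_T = rate_X / rate_T"
    by (simp_all add: assms(10,11) E)
  have pos: "0 < tau_D" "0 < tau_T"
    using rates by (simp_all add: tau)
  have "hit_probability M X Y T D = tau_T / (1 + tau_D + tau_T)"
    by (simp add: hit_probability_def N mD tau)
  \<comment> \<open>Here m(0) = 0 while E[N] is unchanged; the quotient equals
    \<open>rate_X / (rate_X + rate_T)\<close>, that is, P(X < T).\<close>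
  moreover have "hit_probability M X Y T (\<lambda>_. 0) = tau_T / (1 + tau_T)"
    by (simp add: hit_probability_def N m tau)
  \<comment> \<open>As \<open>tau_T\<close> is positive, the zero-delay hit probability is nonzero
    and \<open>tau_T\<close> cancels in the ratio.\<close>
  ultimately have "delay_impairment M X Y T D = 1 - (1 + tau_T) / (1 + tau_D + tau_T)"
    using pos by (simp add: delay_impairment_def)
  also have "\<dots> = tau_D / (tau_T + tau_D + 1)"
    using pos by (simp add: field_simps)
  finally show ?thesis .
qed

end
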